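(* Let $\Omega$ be a measurable space with $\sigma$-algebra $\mathcal{A}$, let $X$ be a real Banach space with dual $X^*$, and let $g,g_n:\Omega\to X$, $n\in\mathbb{N}$, be scalarly measurable functions. Let $m,m_n$, $n\in\mathbb{N}$, be finite nonnegative measures on $(\Omega,\mathcal{A})$. Suppose that (j) the sequence $(g_n)_n$ has scalarly uniformly absolutely continuous $(m_n)$-integrals on $\Omega$; (jj) $g$ is scalarly $m$-integrable; (jjj) $(m_n)_n$ is uniformly absolutely continuous with respect to $m$; (jv) each function $g_n$ is Pettis $m_n$-integrable; (v) for every $A\in\mathcal{A}$ and every $x^*\in X^*$, $$\lim_n\int_A x^*g_n\,dm_n=\int_A x^*g\,dm.$$ Then the function $g$ is Pettis $m$-integrable.
   Context: For $g:\Omega\to X$ and $x^*\in X^*$, $x^*g$ is the function $t\mapsto x^*(g(t))$. $g$ is scalarly measurable (resp. scalarly $m$-integrable) if $x^*g$ is $\mathcal{A}$-measurable (resp. $m$-integrable) for every $x^*\in X^*$. $g$ is Pettis $m$-integrable if it is scalarly $m$-integrable and for every $A\in\mathcal{A}$ there is $\nu(A)\in X$ with $x^*(\nu(A))=\int_A x^*g\,dm$ for all $x^*\in X^*$. A sequence $(g_n)_n$ with $g_n$ scalarly $m_n$-integrable for each $n$ has scalarly uniformly absolutely continuous $(m_n)$-integrals on $\Omega$ if for every $\varepsilon>0$ there is $\delta>0$ such that for every $n\in\mathbb{N}$ and $A\in\mathcal{A}$: $m_n(A)<\delta$ implies $\sup\{\int_A|x^*g_n|\,dm_n:\|x^*\|\le1\}<\varepsilon$.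 $(m_n)_n$ is uniformly absolutely continuous with respect to $m$ if for each $\varepsilon>0$ there is $\delta>0$ such that for every $E\in\mathcal{A}$: $m(E)<\delta$ implies $\sup_n m_n(E)<\varepsilon$. *)

theory Defs
  imports "HOL-Analysis.Analysis"
begin

text \<open>
  The dual of a real normed space is the type of bounded linear functionals
  \<^typ>\<open>'a \<Rightarrow>\<^sub>L real\<close> with the operator norm. A function on a measurable space
  is a total function; only its values on the space of the measure matter.
\<close>

definition scalarly_measurable ::
  "'b measure \<Rightarrow> ('b \<Rightarrow> 'a::real_normed_vector) \<Rightarrow> bool" where
  "scalarly_measurable M g \<longleftrightarrow>
     (\<forall>f :: 'a \<Rightarrow>\<^sub>L real. (\<lambda>t. blinfun_apply f (g t)) \<in> borel_measurable M)"

definition scalarly_integrable ::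
  "'b measure \<Rightarrow> ('b \<Rightarrow> 'a::real_normed_vector) \<Rightarrow> bool" where
  "scalarly_integrable M g \<longleftrightarrow>
     (\<forall>f :: 'a \<Rightarrow>\<^sub>L real. integrable M (\<lambda>t. blinfun_apply f (g t)))"

definition Pettis_integrable ::
  "'b measure \<Rightarrow> ('b \<Rightarrow> 'a::real_normed_vector) \<Rightarrow> bool" where
  "Pettis_integrable M g \<longleftrightarrow>
     scalarly_integrable M g \<and>
     (\<forall>A\<in>sets M. \<exists>\<nu> :: 'a. \<forall>f :: 'a \<Rightarrow>\<^sub>L real.
        blinfun_apply f \<nu> = (LINT t:A|M. blinfun_apply f (g t)))"

text \<open>
  The suprema below are taken in \<^typ>\<open>ennreal\<close>, since the supremum of an
  unbounded set of reals is unspecified. All measures are meant to share one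
  \<sigma>-algebra, which makes quantifying \<open>A\<close> over \<open>sets (m n)\<close> the same as
  quantifying over it.
\<close>

definition scalarly_uac_integrals ::
  "(nat \<Rightarrow> 'b measure) \<Rightarrow> (nat \<Rightarrow> 'b \<Rightarrow> 'a::real_normed_vector) \<Rightarrow> bool" where
  "scalarly_uac_integrals m g \<longleftrightarrow>
     (\<forall>n. scalarly_integrable (m n) (g n)) \<and>
     (\<forall>\<epsilon>>0::real. \<exists>\<delta>>0::real. \<forall>n. \<forall>A\<in>sets (m n).
        emeasure (m n) A < ennreal \<delta> \<longrightarrow>
        (SUP f\<in>{f :: 'a \<Rightarrow>\<^sub>L real. norm f \<le> 1}.
           ennreal (LINT t:A|m n. \<bar>blinfun_apply f (g n t)\<bar>)) < ennreal \<epsilon>)"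

definition uniformly_absolutely_continuous ::
  "'b measure \<Rightarrow> (nat \<Rightarrow> 'b measure) \<Rightarrow> bool" where
  "uniformly_absolutely_continuous M m \<longleftrightarrow>
     (\<forall>\<epsilon>>0::real. \<exists>\<delta>>0::real. \<forall>E\<in>sets M.
        emeasure M E < ennreal \<delta> \<longrightarrow> (SUP n. emeasure (m n) E) < ennreal \<epsilon>)"

end

theory Submission
  imports Defs
begin

text \<open>
  Fix a measurable set \<open>A\<close> and put \<open>\<phi> f = \<integral>\<^bsub>A\<^esub> f g dm\<close> for \<open>f\<close> in the dual of \<open>X\<close>. The Pettis
  integrals \<open>y\<^sub>n\<close> of \<open>g\<^sub>n\<close> over \<open>A\<close> satisfy \<open>f y\<^sub>n \<rightarrow> \<phi> f\<close> for every \<open>f\<close>, so \<open>\<phi>\<close> is a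
  weak-star limit of points of \<open>X\<close>; the question is whether the linear functional \<open>\<phi>\<close> on the dual
  is itself evaluation at a point of \<open>X\<close>.

  A duality argument (\<open>represented_by_point_if_small_on_annihilators\<close>) shows that \<open>\<phi>\<close> is such an
  evaluation as soon as its norm on the annihilator of \<open>y\<^sub>0, \<dots>, y\<^bsub>k-1\<^esub>\<close> tends to \<open>0\<close> with \<open>k\<close>.
  If this fails, there are \<open>c > 0\<close> and functionals \<open>x\<^sub>k\<close> in the dual unit ball that vanish at
  \<open>y\<^sub>0, \<dots>, y\<^bsub>k-1\<^esub>\<close> and have \<open>\<phi> x\<^sub>k \<ge> c\<close>. These properties survive convex combinations.
  The scalar functions \<open>x\<^sub>k g\<close> are bounded at each point \<open>t\<close> by \<open>\<parallel>g t\<parallel>\<close>, so suitable convex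
  combinations \<open>z\<^sub>j\<close> of the tails make \<open>z\<^sub>j g\<close> converge almost everywhere
  (\<open>forward_convex_combinations_AE_convergent\<close>). Let \<open>G\<close> be a generalized limit of \<open>(z\<^sub>j)\<close> in
  the dual unit ball (\<open>bounded_functionals_generalized_limit\<close>). Because \<open>g\<close> is a function with
  values in \<open>X\<close>, the almost everywhere limit of \<open>z\<^sub>j g\<close> has to be \<open>G g\<close>. The uniform absolute
  continuity of the integrals passes from the \<open>g\<^sub>n\<close> to \<open>g\<close>
  (\<open>uac_scalar_integrals_of_limit\<close>), so that Vitali's theorem gives \<open>\<phi> G \<ge> c\<close>. On the other
  hand \<open>G\<close> vanishes at every \<open>y\<^sub>n\<close>, whence \<open>\<phi> G = lim G y\<^sub>n = 0\<close>, a contradiction.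
\<close>

section \<open>The Hahn--Banach theorem for sublinear functionals\<close>

definition sublinear :: "('a::real_vector \<Rightarrow> real) \<Rightarrow> bool" where
  "sublinear p \<longleftrightarrow> (\<forall>x y. p (x + y) \<le> p x + p y) \<and> (\<forall>c\<ge>0. \<forall>x. p (c *\<^sub>R x) = c * p x)"

lemma sublinearI:
  assumes add: "\<And>x y. p (x + y) \<le> p x + p y"
    and scale: "\<And>c x. 0 < c \<Longrightarrow> p (c *\<^sub>R x) \<le> c * p x"
    and zero: "p 0 = 0"
  shows "sublinear p"
proof -
  have "p (c *\<^sub>R x) = c * p x" if "0 \<le> c" for c x
  proof (cases "c = 0")
    case False
    with that have c: "0 < c" by simp
    have "p (inverse c *\<^sub>R (c *\<^sub>R x)) \<le> inverse c * p (c *\<^sub>R x)"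
      using c by (intro scale) simp
    then have "c * p x \<le> p (c *\<^sub>R x)" using c by (simp add: field_simps)
    with scale[OF c, of x] show ?thesis by simp
  qed (simp add: zero)
  with add show ?thesis by (simp add: sublinear_def)
qed

lemma sublinear_bounds:
  assumes "sublinear p"
  shows "p 0 = 0" "- p (- x) \<le> p x"
proof -
  have "p (0 *\<^sub>R (0::'a)) = 0 * p 0" using assms unfolding sublinear_def by blast
  then show z: "p 0 = 0" by simp
  have "p (x + (- x)) \<le> p x + p (- x)" using assms unfolding sublinear_def by blast
  with z show "- p (- x) \<le> p x" by simp
qed

text \<open>
  The functional \<open>q x = inf\<^bsub>t \<ge> 0\<^esub> (p (x + t y) - t p y)\<close>. Since \<open>q \<le> p\<close>, a minimal sublinear
  functional \<open>p\<close> equals its tilt in every direction \<open>y\<close>, and the last inequality then gives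
  superadditivity, hence linearity.
\<close>
lemma sublinear_tilt:
  fixes p :: "'a::real_vector \<Rightarrow> real"
  assumes p: "sublinear p"
  obtains q where "sublinear q" "q \<le> p" "\<And>x. q x \<le> p (x + y) - p y"
proof -
  have add: "p (x + z) \<le> p x + p z" for x z
    using p by (auto simp: sublinear_def)
  have scale: "p (c *\<^sub>R x) = c * p x" if "0 \<le> c" for c x
    using p that by (auto simp: sublinear_def)
  define S where "S x = (\<lambda>t. p (x + t *\<^sub>R y) - t * p y) ` {0..}" for x
  define q where "q x = Inf (S x)" for x
  have ne: "S x \<noteq> {}" for x by (auto simp: S_def)
  have lower: "- p (- x) \<le> s" if "s \<in> S x" for s x
  proof -
    obtain t where t: "0 \<le> t" "s = p (x + t *\<^sub>R y) - t * p y" using \<open>s \<in> S x\<close> by (auto simp: S_def)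
    have "p (t *\<^sub>R y) \<le> p (x + t *\<^sub>R y) + p (- x)" using add[of "x + t *\<^sub>R y" "- x"] by simp
    with t scale[of t y] show ?thesis by simp
  qed
  have bdd: "bdd_below (S x)" for x using lower by (intro bdd_belowI)
  have le: "q x \<le> p (x + t *\<^sub>R y) - t * p y" if "0 \<le> t" for x t
    unfolding q_def using that by (intro cInf_lower bdd) (auto simp: S_def)
  have "sublinear q"
  proof (rule sublinearI)
    fix x z
    have "q (x + z) - u \<le> v" if "u \<in> S x" "v \<in> S z" for u v
    proof -
      obtain s t where st: "0 \<le> s" "0 \<le> t"
        "u = p (x + s *\<^sub>R y) - s * p y" "v = p (z + t *\<^sub>R y) - t * p y"
        using \<open>u \<in> S x\<close> \<open>v \<in> S z\<close> by (auto simp: S_def)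
      have "p ((x + z) + (s + t) *\<^sub>R y) \<le> p (x + s *\<^sub>R y) + p (z + t *\<^sub>R y)"
        using add[of "x + s *\<^sub>R y" "z + t *\<^sub>R y"] by (simp add: algebra_simps)
      with st le[of "s + t" "x + z"] show ?thesis by (simp add: algebra_simps)
    qed
    then have "q (x + z) - u \<le> q z" if "u \<in> S x" for u
      unfolding q_def[of z] using that by (intro cInf_greatest ne) auto
    then have "q (x + z) - q z \<le> u" if "u \<in> S x" for u using that by force
    then have "q (x + z) - q z \<le> q x"
      unfolding q_def[of x] by (intro cInf_greatest ne) auto
    then show "q (x + z) \<le> q x + q z" by simp
  next
    fix c :: real and x assume c: "0 < c"
    have "q (c *\<^sub>R x) / c \<le> u" if "u \<in> S x" for u
    proof -
      obtain s where s: "0 \<le> s" "u = p (x + s *\<^sub>R y) - s * p y"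
        using \<open>u \<in> S x\<close> by (auto simp: S_def)
      have "p (c *\<^sub>R x + (c * s) *\<^sub>R y) = c * p (x + s *\<^sub>R y)"
        using scale[of c "x + s *\<^sub>R y"] c by (simp add: algebra_simps)
      moreover have "q (c *\<^sub>R x) \<le> p (c *\<^sub>R x + (c * s) *\<^sub>R y) - c * s * p y"
        using s c by (intro le) simp
      ultimately have "q (c *\<^sub>R x) \<le> c * u"
        unfolding s(2) by (simp add: right_diff_distrib mult.assoc)
      then show ?thesis using c by (simp add: field_simps)
    qed
    then have "q (c *\<^sub>R x) / c \<le> q x"
      unfolding q_def[of x] by (intro cInf_greatest ne) auto
    then show "q (c *\<^sub>R x) \<le> c * q x" using c by (simp add: field_simps)
  next
    have "0 \<le> q 0" unfolding q_def
      using lower[of _ 0] sublinear_bounds[OF p] by (intro cInf_greatest ne) simp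
    with le[of 0 0] sublinear_bounds[OF p] show "q 0 = 0" by simp
  qed
  moreover have "q \<le> p" using le[of 0] by (auto simp: le_fun_def)
  moreover have "q x \<le> p (x + y) - p y" for x using le[of 1 x] by simp
  ultimately show ?thesis by (rule that)
qed

text \<open>
  The pointwise infimum is finite because \<open>- p (- x) \<le> - q (- x) \<le> q x\<close> for every \<open>q\<close> in the chain.
\<close>
lemma sublinear_chain_Inf:
  fixes C :: "('a::real_vector \<Rightarrow> real) set"
  assumes "C \<noteq> {}" and sub: "\<And>q. q \<in> C \<Longrightarrow> sublinear q" and below: "\<And>q. q \<in> C \<Longrightarrow> q \<le> p"
    and chain: "\<And>q r. q \<in> C \<Longrightarrow> r \<in> C \<Longrightarrow> q \<le> r \<or> r \<le> q"
  obtains l where "sublinear l" "\<And>q. q \<in> C \<Longrightarrow> l \<le> q"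
proof -
  define l where "l x = (INF q\<in>C. q x)" for x
  have bdd: "bdd_below ((\<lambda>q. q x) ` C)" for x
  proof (rule bdd_belowI2)
    fix q assume "q \<in> C"
    with sublinear_bounds(2)[OF sub, of q x] le_funD[OF below, of q "- x"]
    show "- p (- x) \<le> q x" by simp
  qed
  have le: "l x \<le> q x" if "q \<in> C" for q x
    unfolding l_def using that by (intro cINF_lower bdd)
  have ge: "c \<le> l x" if "\<And>q. q \<in> C \<Longrightarrow> c \<le> q x" for c x
    unfolding l_def using that assms(1) by (intro cINF_greatest)
  have "sublinear l"
  proof (rule sublinearI)
    fix x y
    have *: "l (x + y) \<le> q x + r y" if qr: "q \<in> C" "r \<in> C" for q r
    proof -
      have q: "l (x + y) \<le> q x + q y" and r: "l (x + y) \<le> r x + r y"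
        using le[of _ "x + y"] sub qr unfolding sublinear_def by (meson order_trans)+
      from chain[OF qr] show ?thesis
      proof
        assume "q \<le> r" then have "q y \<le> r y" by (simp add: le_fun_def)
        with q show ?thesis by simp
      next
        assume "r \<le> q" then have "r x \<le> q x" by (simp add: le_fun_def)
        with r show ?thesis by simp
      qed
    qed
    have "l (x + y) - q x \<le> l y" if "q \<in> C" for q
      using *[OF that] by (intro ge) force
    then have "l (x + y) - l y \<le> l x" by (intro ge) force
    then show "l (x + y) \<le> l x + l y" by simp
  next
    fix c :: real and x :: 'a assume c: "0 < c"
    have "l (c *\<^sub>R x) / c \<le> l x"
    proof (rule ge)
      fix q assume q: "q \<in> C"
      have "q (c *\<^sub>R x) = c * q x" using sub[OF q] c by (simp add: sublinear_def)
      with le[OF q, of "c *\<^sub>R x"] c show "l (c *\<^sub>R x) / c \<le> q x" by (simp add: field_simps)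
    qed
    then show "l (c *\<^sub>R x) \<le> c * l x" using c by (simp add: field_simps)
  next
    show "l 0 = 0" unfolding l_def using assms(1) sub by (simp add: sublinear_bounds(1))
  qed
  with le show ?thesis by (intro that) (auto simp: le_fun_def)
qed

text \<open>
  Zorn's lemma gives a minimal sublinear functional below \<open>p\<close>, and minimality forces linearity.
  The value at \<open>y\<close> is prescribed by looking only below the tilt \<open>p'\<close> of \<open>p\<close> in direction \<open>y\<close>, for
  which \<open>p' (- y) \<le> - p y\<close>.
\<close>
lemma Hahn_Banach_sublinear:
  fixes p :: "'a::real_vector \<Rightarrow> real"
  assumes p: "sublinear p"
  obtains f where "linear f" "\<And>x. f x \<le> p x" "f y = p y"
proof -
  obtain p' where p': "sublinear p'" "p' \<le> p" "\<And>x. p' x \<le> p (x + y) - p y"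
    using sublinear_tilt[OF p] by blast
  define S where "S = {q. sublinear q \<and> q \<le> p'}"
  have "\<exists>q\<in>S. \<forall>r\<in>S. q \<ge> r \<longrightarrow> r = q"
  proof (rule predicate_Zorn)
    show "partial_order_on S (relation_of (\<lambda>q r. q \<ge> r) S)"
      by (auto simp: partial_order_on_def preorder_on_def refl_on_def trans_def antisym_def
          relation_of_def)
  next
    fix C assume "C \<in> Chains (relation_of (\<lambda>q r. q \<ge> r) S)"
    then have C: "C \<subseteq> S" "\<And>q r. q \<in> C \<Longrightarrow> r \<in> C \<Longrightarrow> q \<le> r \<or> r \<le> q"
      by (auto simp: Chains_def relation_of_def)
    show "\<exists>u\<in>S. \<forall>q\<in>C. q \<ge> u"
    proof (cases "C = {}")
      case True
      with p' show ?thesis by (auto simp: S_def)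
    next
      case False
      obtain l where l: "sublinear l" "\<And>q. q \<in> C \<Longrightarrow> l \<le> q"
        using sublinear_chain_Inf[OF False, of p'] C by (auto simp: S_def)
      moreover have "l \<le> p'"
        using False C(1) l(2) unfolding S_def by (metis (mono_tags, lifting) all_not_in_conv mem_Collect_eq order_trans subsetD)
      ultimately show ?thesis by (auto simp: S_def)
    qed
  qed
  then obtain q where q: "sublinear q" "q \<le> p'"
    and min: "\<And>r. sublinear r \<Longrightarrow> r \<le> q \<Longrightarrow> r = q"
    unfolding S_def by (force intro: order_trans)
  have add: "q (x + z) = q x + q z" for x z
  proof (rule antisym)
    obtain r where r: "sublinear r" "r \<le> q" "\<And>x. r x \<le> q (x + z) - q z"
      using sublinear_tilt[OF q(1)] by blast
    from r(3)[of x] min[OF r(1,2)] show "q x + q z \<le> q (x + z)" by simp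
  qed (use q in \<open>simp add: sublinear_def\<close>)
  have neg: "q (- x) = - q x" for x
    using add[of x "- x"] sublinear_bounds(1)[OF q(1)] by simp
  have "q (c *\<^sub>R x) = c * q x" for c x
  proof (cases "0 \<le> c")
    case False
    then have "q (- ((- c) *\<^sub>R x)) = - ((- c) * q x)"
      unfolding neg using q(1) by (simp add: sublinear_def del: scaleR_minus_left)
    then show ?thesis by simp
  qed (use q in \<open>simp add: sublinear_def\<close>)
  then have "linear q" by (intro linearI) (simp_all add: add)
  moreover have le: "q x \<le> p x" for x using q(2) p'(2) by (meson le_fun_def order_trans)
  moreover have "q y = p y"
  proof -
    have "q (- y) \<le> p 0 - p y" using q(2) p'(3)[of "- y"] by (auto simp: le_fun_def intro: order_trans)
    then show ?thesis using le[of y] neg sublinear_bounds(1)[OF p] by simp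
  qed
  ultimately show ?thesis by (rule that)
qed

section \<open>Functionals on a normed space\<close>

lemma linear_norm_bounded_blinfun:
  fixes f :: "'a::real_normed_vector \<Rightarrow> real"
  assumes f: "linear f" and le: "\<And>x. f x \<le> norm x"
  obtains F :: "'a \<Rightarrow>\<^sub>L real" where "norm F \<le> 1" "\<And>x. F x = f x"
proof -
  have bound: "\<bar>f x\<bar> \<le> norm x" for x
    using le[of x] le[of "- x"] by (simp add: linear_neg[OF f])
  have bl: "bounded_linear f"
    using f bound by (intro bounded_linear_intro[where K = 1])
      (simp_all add: linear_add linear_scale)
  show ?thesis
  proof (rule that)
    show "norm (Blinfun f) \<le> 1"
      using bound by (intro norm_blinfun_bound) (simp_all add: bounded_linear_Blinfun_apply[OF bl])
  qed (simp add: bounded_linear_Blinfun_apply[OF bl])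
qed

lemma norming_functional:
  fixes x :: "'a::real_normed_vector"
  obtains F :: "'a \<Rightarrow>\<^sub>L real" where "norm F \<le> 1" "F x = norm x"
proof -
  have "sublinear (norm :: 'a \<Rightarrow> real)"
    by (auto simp: sublinear_def norm_triangle_ineq)
  then obtain f where f: "linear f" "\<And>z. f z \<le> norm z" "f x = norm x"
    using Hahn_Banach_sublinear by blast
  then show ?thesis using linear_norm_bounded_blinfun[OF f(1,2)] that by metis
qed

text \<open>
  A substitute for weak-star compactness of the dual ball: a linear functional below the sublinear
  functional \<open>x \<mapsto> limsup\<^sub>j F\<^sub>j x\<close> agrees with \<open>lim\<^sub>j F\<^sub>j x\<close> wherever this limit exists.
\<close>
lemma bounded_functionals_generalized_limit:
  fixes F :: "nat \<Rightarrow> 'a::real_normed_vector \<Rightarrow>\<^sub>L real"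
  assumes F: "\<And>j. norm (F j) \<le> 1"
  obtains G :: "'a \<Rightarrow>\<^sub>L real"
  where "norm G \<le> 1" "\<And>x l. (\<lambda>j. F j x) \<longlonglongrightarrow> l \<Longrightarrow> G x = l"
proof -
  \<comment> \<open>\<open>p x\<close> is the limit superior of \<open>F j x\<close>, written as the infimum of its eventual upper bounds.\<close>
  define U where "U x = {c. \<forall>\<^sub>F j in sequentially. F j x \<le> c}" for x
  define p where "p x = Inf (U x)" for x
  have bound: "\<bar>F j x\<bar> \<le> norm x" for j x
    using norm_blinfun[of "F j" x] F[of j] mult_right_mono[OF F[of j], of "norm x"] by simp
  have inU: "norm x \<in> U x" for x
    using bound[of _ x] by (auto simp: U_def abs_le_iff)
  have lower: "- norm x \<le> c" if "c \<in> U x" for x c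
  proof -
    from that obtain j where "F j x \<le> c" by (auto simp: U_def dest!: eventually_happens)
    with bound[of j x] show ?thesis by simp
  qed
  have le: "p x \<le> c" if "c \<in> U x" for x c
    unfolding p_def using that lower by (intro cInf_lower bdd_belowI)
  have ge: "c \<le> p x" if "\<And>d. d \<in> U x \<Longrightarrow> c \<le> d" for x c
    unfolding p_def using inU that by (intro cInf_greatest) auto
  have "sublinear p"
  proof (rule sublinearI)
    fix x y
    have *: "p (x + y) \<le> c + d" if "c \<in> U x" "d \<in> U y" for c d
    proof (rule le)
      from that have "\<forall>\<^sub>F j in sequentially. F j x \<le> c \<and> F j y \<le> d"
        by (simp add: U_def eventually_conj_iff)
      then show "c + d \<in> U (x + y)"
        unfolding U_def mem_Collect_eq by eventually_elim (simp add: blinfun.add_right)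
    qed
    have "p (x + y) - c \<le> p y" if "c \<in> U x" for c
      using *[OF that] by (intro ge) force
    then have "p (x + y) - p y \<le> p x" by (intro ge) force
    then show "p (x + y) \<le> p x + p y" by simp
  next
    fix c :: real and x :: 'a assume c: "0 < c"
    have "p (c *\<^sub>R x) / c \<le> p x"
    proof (rule ge)
      fix d assume "d \<in> U x"
      then have "c * d \<in> U (c *\<^sub>R x)" using c by (simp add: U_def blinfun.scaleR_right)
      from le[OF this] c show "p (c *\<^sub>R x) / c \<le> d" by (simp add: field_simps)
    qed
    then show "p (c *\<^sub>R x) \<le> c * p x" using c by (simp add: field_simps)
  next
    show "p 0 = 0" using le[OF inU, of 0] ge[of 0 0] lower[of _ 0] by fastforce
  qed
  then obtain f where f: "linear f" "\<And>x. f x \<le> p x" using Hahn_Banach_sublinear by blast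
  have "f x \<le> norm x" for x using f(2) le[OF inU] by (rule order_trans)
  then obtain G :: "'a \<Rightarrow>\<^sub>L real" where G: "norm G \<le> 1" "\<And>x. G x = f x"
    using linear_norm_bounded_blinfun[OF f(1)] by blast
  have upper: "G x \<le> l" if "(\<lambda>j. F j x) \<longlonglongrightarrow> l" for x l
  proof (rule field_le_epsilon)
    fix e :: real assume "0 < e"
    with that have "\<forall>\<^sub>F j in sequentially. F j x < l + e" by (intro order_tendstoD) auto
    then have "l + e \<in> U x" unfolding U_def mem_Collect_eq by eventually_elim simp
    with f(2)[of x] le G(2) show "G x \<le> l + e" by force
  qed
  have "G x = l" if lim: "(\<lambda>j. F j x) \<longlonglongrightarrow> l" for x l
    using upper[OF lim] upper[of "- x" "- l"] tendsto_minus[OF lim] by (simp add: blinfun.minus_right)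
  with G(1) show ?thesis by (rule that)
qed


section \<open>Functionals on the dual that are evaluations at points\<close>

text \<open>
  This is the one-dimensional step of the Hahn--Banach theorem, read as a statement on the
  subspace \<open>V\<close>: a functional that is bounded by \<open>c\<close> on a hyperplane becomes so on all of \<open>V\<close> after
  subtracting a multiple of the functional that defines the hyperplane. The constant is
  determined on the affine set \<open>y v = 1\<close>, where it has to separate two families of numbers.
\<close>
lemma one_step_extension:
  fixes \<phi> y :: "'a::real_normed_vector \<Rightarrow> real"
  assumes \<phi>: "linear \<phi>" and y: "linear y" and V: "subspace V" and c: "0 \<le> c"
    and le: "\<And>v. v \<in> V \<Longrightarrow> y v = 0 \<Longrightarrow> \<bar>\<phi> v\<bar> \<le> c * norm v"
  obtains a where "\<And>v. v \<in> V \<Longrightarrow> \<bar>\<phi> v - a * y v\<bar> \<le> c * norm v"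
proof (cases "\<exists>v\<in>V. y v \<noteq> 0")
  case False
  with le that[of 0] show ?thesis by simp
next
  case True
  define W where "W = {v\<in>V. y v = 1}"
  have W: "(1 / y v) *\<^sub>R v \<in> W" if "v \<in> V" "y v \<noteq> 0" for v
    using that V y by (simp add: W_def linear_scale subspace_scale)
  with True obtain v1 where v1: "v1 \<in> W" by blast
  define a where "a = (SUP v\<in>W. \<phi> v - c * norm v)"
  have key: "\<phi> v - c * norm v \<le> \<phi> w + c * norm w" if "v \<in> W" "w \<in> W" for v w
  proof -
    have vw: "v - w \<in> V" "y (v - w) = 0"
      using that V y by (auto simp: W_def subspace_diff linear_diff)
    have "\<phi> v - \<phi> w \<le> c * norm (v - w)" using le[OF vw] by (simp add: linear_diff[OF \<phi>])
    also have "\<dots> \<le> c * (norm v + norm w)"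
      using c by (intro mult_left_mono norm_triangle_ineq4)
    finally show ?thesis by (simp add: algebra_simps)
  qed
  have a: "\<bar>\<phi> v - a\<bar> \<le> c * norm v" if "v \<in> W" for v
  proof -
    have "\<phi> v - c * norm v \<le> a"
      unfolding a_def using key that by (intro cSUP_upper bdd_aboveI2) auto
    moreover have "a \<le> \<phi> v + c * norm v"
      unfolding a_def using key that v1 by (intro cSUP_least) auto
    ultimately show ?thesis by simp
  qed
  show ?thesis
  proof (rule that)
    fix v assume v: "v \<in> V"
    show "\<bar>\<phi> v - a * y v\<bar> \<le> c * norm v"
    proof (cases "y v = 0")
      case False
      have "\<bar>\<phi> v - a * y v\<bar> = \<bar>y v\<bar> * \<bar>\<phi> ((1 / y v) *\<^sub>R v) - a\<bar>"
        using False by (simp add: linear_scale[OF \<phi>] right_diff_distrib mult.commute flip: abs_mult)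
      also have "\<dots> \<le> \<bar>y v\<bar> * (c * norm ((1 / y v) *\<^sub>R v))"
        by (intro mult_left_mono a W v False) simp
      also have "\<dots> = c * norm v" using False by simp
      finally show ?thesis .
    qed (use le v in simp)
  qed
qed

text \<open>
  The annihilator of finitely many points has finite codimension, so that finitely many extension
  steps suffice. Each of them subtracts a multiple of evaluation at some \<open>y i\<close>; together they
  subtract evaluation at a point in the span of the \<open>y i\<close>.
\<close>
lemma approx_by_point_evaluation:
  fixes \<phi> :: "('a::real_normed_vector \<Rightarrow>\<^sub>L real) \<Rightarrow> real" and y :: "nat \<Rightarrow> 'a"
  assumes "linear \<phi>" and c: "0 \<le> c"
    and "\<And>f :: 'a \<Rightarrow>\<^sub>L real. (\<And>i. i < k \<Longrightarrow> blinfun_apply f (y i) = 0) \<Longrightarrow> \<bar>\<phi> f\<bar> \<le> c * norm f"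
  shows "\<exists>w. \<forall>f :: 'a \<Rightarrow>\<^sub>L real. \<bar>\<phi> f - blinfun_apply f w\<bar> \<le> c * norm f"
  using assms(1,3)
proof (induction k arbitrary: \<phi>)
  case 0
  then show ?case by (intro exI[of _ 0]) simp
next
  case (Suc k)
  define V where "V = {f :: 'a \<Rightarrow>\<^sub>L real. \<forall>i<k. blinfun_apply f (y i) = 0}"
  have lin: "linear (\<lambda>f :: 'a \<Rightarrow>\<^sub>L real. blinfun_apply f u)" for u
    by (intro linearI) (simp_all add: blinfun.add_left blinfun.scaleR_left)
  have "subspace V"
    by (auto simp: V_def subspace_def blinfun.add_left blinfun.scaleR_left)
  moreover have "\<bar>\<phi> f\<bar> \<le> c * norm f" if "f \<in> V" "blinfun_apply f (y k) = 0" for f :: "'a \<Rightarrow>\<^sub>L real"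
  proof (rule Suc.prems(2))
    show "blinfun_apply f (y i) = 0" if "i < Suc k" for i
      using that \<open>f \<in> V\<close> \<open>blinfun_apply f (y k) = 0\<close> by (cases "i = k") (simp_all add: V_def)
  qed
  ultimately obtain a where a: "\<And>f :: 'a \<Rightarrow>\<^sub>L real. f \<in> V \<Longrightarrow> \<bar>\<phi> f - a * blinfun_apply f (y k)\<bar> \<le> c * norm f"
    using one_step_extension[OF Suc.prems(1) lin[of "y k"] _ c, of V] by blast
  have "\<exists>w. \<forall>f :: 'a \<Rightarrow>\<^sub>L real. \<bar>(\<phi> f - a * blinfun_apply f (y k)) - blinfun_apply f w\<bar> \<le> c * norm f"
  proof (rule Suc.IH)
    show "linear (\<lambda>f :: 'a \<Rightarrow>\<^sub>L real. \<phi> f - a * blinfun_apply f (y k))"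
      using Suc.prems(1) lin[of "y k"] by (intro linearI)
        (simp_all add: linear_add linear_scale blinfun.add_left blinfun.scaleR_left algebra_simps)
  qed (use a in \<open>simp add: V_def\<close>)
  then obtain w where w: "\<And>f :: 'a \<Rightarrow>\<^sub>L real. \<bar>(\<phi> f - a * blinfun_apply f (y k)) - blinfun_apply f w\<bar> \<le> c * norm f" by blast
  have eq: "\<phi> f - blinfun_apply f (a *\<^sub>R y k + w) = (\<phi> f - a * blinfun_apply f (y k)) - blinfun_apply f w" for f :: "'a \<Rightarrow>\<^sub>L real"
    by (simp add: blinfun.add_right blinfun.scaleR_right)
  with w have "\<forall>f :: 'a \<Rightarrow>\<^sub>L real. \<bar>\<phi> f - blinfun_apply f (a *\<^sub>R y k + w)\<bar> \<le> c * norm f"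
    by (simp only: eq simp_thms)
  then show ?case ..
qed

text \<open>
  By the previous lemma \<open>\<phi>\<close> is a limit, in the norm of the bidual, of evaluations at points
  \<open>w n\<close>. As norming functionals make the embedding into the bidual isometric, \<open>(w n)\<close> is Cauchy
  and its limit represents \<open>\<phi>\<close>.
\<close>
lemma represented_by_point_if_small_on_annihilators:
  fixes \<phi> :: "('a::banach \<Rightarrow>\<^sub>L real) \<Rightarrow> real" and y :: "nat \<Rightarrow> 'a"
  assumes \<phi>: "linear \<phi>"
    and small: "\<And>c. 0 < c \<Longrightarrow> \<exists>k. \<forall>f :: 'a \<Rightarrow>\<^sub>L real. (\<forall>i<k. blinfun_apply f (y i) = 0) \<longrightarrow> \<bar>\<phi> f\<bar> \<le> c * norm f"
  shows "\<exists>u. \<forall>f :: 'a \<Rightarrow>\<^sub>L real. \<phi> f = blinfun_apply f u"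
proof -
  have "\<exists>w. \<forall>f :: 'a \<Rightarrow>\<^sub>L real. \<bar>\<phi> f - blinfun_apply f w\<bar> \<le> (1/2) ^ n * norm f" for n :: nat
  proof -
    obtain k where "\<forall>f :: 'a \<Rightarrow>\<^sub>L real. (\<forall>i<k. blinfun_apply f (y i) = 0) \<longrightarrow> \<bar>\<phi> f\<bar> \<le> (1/2) ^ n * norm f"
      using small[of "(1/2) ^ n"] by auto
    then show ?thesis by (intro approx_by_point_evaluation[OF \<phi>, of _ k y]) simp_all
  qed
  then obtain w where w: "\<And>n (f :: 'a \<Rightarrow>\<^sub>L real). \<bar>\<phi> f - blinfun_apply f (w n)\<bar> \<le> (1/2) ^ n * norm f" by metis
  have dist: "norm (w m - w n) \<le> (1/2) ^ m + (1/2) ^ n" for m n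
  proof -
    obtain F :: "'a \<Rightarrow>\<^sub>L real" where F: "norm F \<le> 1" "blinfun_apply F (w m - w n) = norm (w m - w n)"
      using norming_functional by blast
    have "norm (w m - w n) = (\<phi> F - blinfun_apply F (w n)) - (\<phi> F - blinfun_apply F (w m))"
      using F(2) by (simp add: blinfun.diff_right)
    also have "\<dots> \<le> (1/2) ^ m * norm F + (1/2) ^ n * norm F" using w[of F m] w[of F n] by linarith
    also have "\<dots> \<le> (1/2) ^ m + (1/2) ^ n"
      using F(1) by (intro add_mono mult_left_le) auto
    finally show ?thesis .
  qed
  have "Cauchy w"
  proof (rule metric_CauchyI)
    fix e :: real assume e: "0 < e"
    obtain N where N: "(1/2 :: real) ^ N < e / 2" using real_arch_pow_inv[of "e/2" "1/2"] e by auto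
    have "dist (w m) (w n) < e" if "N \<le> m" "N \<le> n" for m n
    proof -
      have "(1/2 :: real) ^ m \<le> (1/2) ^ N" "(1/2 :: real) ^ n \<le> (1/2) ^ N"
        using that by (auto intro: power_decreasing)
      with dist[of m n] N show ?thesis unfolding dist_norm by linarith
    qed
    then show "\<exists>N. \<forall>m\<ge>N. \<forall>n\<ge>N. dist (w m) (w n) < e" by blast
  qed
  then obtain u where u: "w \<longlonglongrightarrow> u" using Cauchy_convergent by (auto simp: convergent_def)
  have "\<phi> f = blinfun_apply f u" for f :: "'a \<Rightarrow>\<^sub>L real"
  proof -
    have "(\<lambda>n. (1/2) ^ n * norm f) \<longlonglongrightarrow> 0"
      by (intro tendsto_mult_left_zero LIMSEQ_power_zero) simp
    then have "(\<lambda>n. \<phi> f - blinfun_apply f (w n)) \<longlonglongrightarrow> 0" by (rule Lim_null_comparison[rotated]) (use w in simp)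
    moreover have "(\<lambda>n. \<phi> f - blinfun_apply f (w n)) \<longlonglongrightarrow> \<phi> f - blinfun_apply f u" by (intro tendsto_intros u)
    ultimately show ?thesis using LIMSEQ_unique by fastforce
  qed
  then show ?thesis by blast
qed

section \<open>Convergence of scalar functions\<close>

text \<open>
  Pointwise boundedness allows dividing all functions by \<open>1 + G\<close>, where \<open>G\<close> is their pointwise
  supremum; the quotients \<open>S v\<close> are bounded by \<open>1\<close> and hence lie in a bounded subset of \<open>L\<^sup>2\<close>. In
  the convex hulls \<open>D n\<close> of the tails, elements that almost minimize the \<open>L\<^sup>2\<close> norm form a Cauchy
  sequence by the parallelogram law, and a rapidly Cauchy subsequence converges almost everywhere.
  The weight is built from \<open>G\<close> instead of \<open>B\<close> because \<open>G\<close>, a countable supremum, is measurable,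
  while \<open>B\<close> will be \<open>t \<mapsto> \<parallel>g t\<parallel>\<close> for a function \<open>g\<close> that is only scalarly measurable.
\<close>
lemma forward_convex_combinations_AE_convergent:
  fixes x :: "nat \<Rightarrow> 'v::real_vector" and T :: "'v \<Rightarrow> 'b \<Rightarrow> real"
  assumes fin: "finite_measure M" and T: "\<And>t. linear (\<lambda>v. T v t)"
    and meas: "\<And>n. T (x n) \<in> borel_measurable M"
    and bound: "\<And>n t. \<bar>T (x n) t\<bar> \<le> B t"
  obtains z where "\<And>j. z j \<in> convex hull (x ` {j..})" "AE t in M. convergent (\<lambda>j. T (z j) t)"
proof -
  interpret finite_measure M by (fact fin)
  note [measurable] = meas
  define G where "G t = (SUP n. \<bar>T (x n) t\<bar>)" for t
  have bdd: "bdd_above (range (\<lambda>n. \<bar>T (x n) t\<bar>))" for t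
    using bound by (intro bdd_aboveI2)
  have G_ge: "\<bar>T (x n) t\<bar> \<le> G t" for n t
    unfolding G_def by (intro cSUP_upper bdd) simp
  have G0: "0 \<le> G t" for t using G_ge[of 0 t] by simp
  have [measurable]: "G \<in> borel_measurable M"
    unfolding G_def by (intro borel_measurable_cSUP bdd) auto
  define D where "D n = convex hull (x ` {n..})" for n
  have D_anti: "D m \<subseteq> D n" if "n \<le> m" for m n
    unfolding D_def using that by (intro hull_mono) auto
  have D_D0: "v \<in> D 0" if "v \<in> D n" for v n using D_anti[of 0 n] that by auto
  have D_convex: "convex (D n)" for n unfolding D_def by (rule convex_convex_hull)
  have D_ne: "D n \<noteq> {}" for n by (simp add: D_def)
  have T_comb: "T (u *\<^sub>R v + r *\<^sub>R w) t = u * T v t + r * T w t" for u r v w t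
    by (simp add: linear_add[OF T] linear_scale[OF T])
  have "D 0 \<subseteq> {v. T v \<in> borel_measurable M \<and> (\<forall>t. \<bar>T v t\<bar> \<le> G t)}"
    unfolding D_def
  proof (intro hull_minimal subsetI convexI)
    fix u r :: real and v w
    assume ur: "0 \<le> u" "0 \<le> r" "u + r = 1"
      and v: "v \<in> {v. T v \<in> borel_measurable M \<and> (\<forall>t. \<bar>T v t\<bar> \<le> G t)}"
      and w: "w \<in> {v. T v \<in> borel_measurable M \<and> (\<forall>t. \<bar>T v t\<bar> \<le> G t)}"
    have "\<bar>u * T v t + r * T w t\<bar> \<le> G t" for t
    proof -
      have "\<bar>u * T v t + r * T w t\<bar> \<le> u * \<bar>T v t\<bar> + r * \<bar>T w t\<bar>"
        using ur abs_triangle_ineq[of "u * T v t" "r * T w t"] by (simp add: abs_mult)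
      also have "\<dots> \<le> u * G t + r * G t" using v w ur by (intro add_mono mult_left_mono) auto
      also have "\<dots> = G t" using ur by (simp flip: distrib_right)
      finally show ?thesis .
    qed
    moreover have "(\<lambda>t. u * T v t + r * T w t) \<in> borel_measurable M" using v w by (intro borel_measurable_add borel_measurable_times borel_measurable_const) auto
    ultimately show "u *\<^sub>R v + r *\<^sub>R w \<in> {v. T v \<in> borel_measurable M \<and> (\<forall>t. \<bar>T v t\<bar> \<le> G t)}"
      unfolding mem_Collect_eq T_comb[abs_def] by (simp add: T_comb[abs_def])
  qed (use G_ge meas in auto)
  then have Tm: "T v \<in> borel_measurable M" and TG: "\<bar>T v t\<bar> \<le> G t" if "v \<in> D 0" for v t
    using that by auto
  define S where "S v t = T v t / (1 + G t)" for v t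
  have S_comb: "S (u *\<^sub>R v + r *\<^sub>R w) t = u * S v t + r * S w t" for u r v w t
    using T_comb[of u v r w t] by (simp add: S_def add_divide_distrib)
  have Sm[measurable]: "S v \<in> borel_measurable M" if "v \<in> D 0" for v
    unfolding S_def[abs_def] using Tm[OF that] by measurable
  have S1: "\<bar>S v t\<bar> \<le> 1" if "v \<in> D 0" for v t
    using TG[OF that, of t] G0[of t] by (simp add: S_def field_simps)
  have Si: "integrable M (\<lambda>t. (S v t)\<^sup>2)" if "v \<in> D 0" for v
  proof (rule integrable_const_bound[where B = 1])
    show "AE t in M. norm ((S v t)\<^sup>2) \<le> 1"
      using S1[OF that] by (simp add: abs_square_le_1)
  qed (use Sm[OF that] in measurable)
  define q where "q v = (LINT t|M. (S v t)\<^sup>2)" for v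
  have q0: "0 \<le> q v" for v unfolding q_def by simp
  have q1: "q v \<le> measure M (space M)" if "v \<in> D 0" for v
  proof -
    have "q v \<le> (LINT t|M. 1)" unfolding q_def
      using S1[OF that] by (intro integral_mono Si that) (auto simp: abs_square_le_1)
    then show ?thesis by simp
  qed
  \<comment> \<open>The minimal energies \<open>a n\<close> of the tails increase to a finite limit \<open>L\<close>; the midpoint of two
    almost minimizers from \<open>D n\<close> still has energy at least \<open>a n\<close>, so they are close to each other.\<close>
  define a where "a n = Inf (q ` D n)" for n
  have bddq: "bdd_below (q ` A)" for A using q0 by (intro bdd_belowI2)
  have a_le: "a n \<le> q v" if "v \<in> D n" for n v
    unfolding a_def by (intro cINF_lower bddq that)
  have "incseq a"
    unfolding a_def by (intro incseq_SucI cINF_superset_mono D_ne bddq D_anti) auto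
  moreover have "a n \<le> measure M (space M)" for n
    using D_ne[of n] a_le q1 D_D0 by (meson all_not_in_conv order_trans)
  ultimately obtain L where L: "a \<longlonglongrightarrow> L" "\<And>n. a n \<le> L"
    using incseq_convergent by blast
  have "\<exists>v\<in>D n. q v < a n + 1 / real (Suc n)" for n
    using cInf_lessD[of "q ` D n" "a n + 1 / real (Suc n)"] D_ne[of n] unfolding a_def by auto
  then obtain y where y: "\<And>n. y n \<in> D n" "\<And>n. q (y n) < a n + 1 / real (Suc n)" by metis
  define e where "e n = 2 * (L - a n) + 4 * (1 / real (Suc n))" for n
  have gap: "(LINT t|M. (S (y n) t - S (y k) t)\<^sup>2) \<le> e n" if "n \<le> k" for n k
  proof -
    define mid where "mid = (1/2) *\<^sub>R y n + (1/2) *\<^sub>R y k"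
    have in_n: "y n \<in> D n" "y k \<in> D n" using y(1) D_anti[OF that] by auto
    then have mid: "mid \<in> D n"
      unfolding mid_def by (intro convexD D_convex) auto
    note ints = in_n[THEN D_D0, THEN Si] mid[THEN D_D0, THEN Si]
    have "(S (y n) t - S (y k) t)\<^sup>2 = 2 * (S (y n) t)\<^sup>2 + 2 * (S (y k) t)\<^sup>2 - 4 * (S mid t)\<^sup>2" for t
      unfolding mid_def S_comb by (simp add: power2_eq_square field_simps)
    then have "(LINT t|M. (S (y n) t - S (y k) t)\<^sup>2) = 2 * q (y n) + 2 * q (y k) - 4 * q mid"
      using ints by (simp add: q_def)
    also have "\<dots> \<le> 2 * (a n + 1 / real (Suc n)) + 2 * (L + 1 / real (Suc n)) - 4 * a n"
    proof -
      have "q (y k) < L + 1 / real (Suc k)" using y(2)[of k] L(2)[of k] by linarith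
      moreover have "1 / real (Suc k) \<le> 1 / real (Suc n)" using that by (simp add: frac_le)
      moreover have "q (y n) < a n + 1 / real (Suc n)" "a n \<le> q mid" by (fact y(2), fact a_le[OF mid])
      ultimately show ?thesis unfolding right_diff_distrib distrib_left by linarith
    qed
    also have "\<dots> = e n" unfolding e_def by (simp only: right_diff_distrib distrib_left)
    finally show ?thesis .
  qed
  have "e \<longlonglongrightarrow> 2 * (L - L) + 4 * 0"
    unfolding e_def by (intro tendsto_intros L(1) LIMSEQ_Suc[OF lim_const_over_n])
  then have "e \<longlonglongrightarrow> 0" by simp
  then have ev: "\<forall>\<^sub>F n in sequentially. e n < (1/4) ^ j" for j :: nat
    by (rule order_tendstoD) simp
  have "\<exists>r. \<forall>j. e (r j) < (1/4) ^ j \<and> r j < r (Suc j)"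
  proof (rule dependent_nat_choice)
    show "\<exists>n. e n < (1/4) ^ 0" using ev[of 0] by (auto simp: eventually_sequentially)
    show "\<exists>m. e m < (1/4) ^ Suc j \<and> n < m" for j n
      using eventually_happens[OF eventually_conj[OF ev[of "Suc j"] eventually_gt_at_top[of n]]]
      by auto
  qed
  then obtain r where r: "\<And>j. e (r j) < (1/4) ^ j" "\<And>j. r j < r (Suc j)" by blast
  then have "strict_mono r" by (simp add: strict_mono_Suc_iff)
  define z where "z = y \<circ> r"
  have zD: "z j \<in> D j" for j
    using y(1)[of "r j"] D_anti[OF seq_suble[OF \<open>strict_mono r\<close>, of j]] by (auto simp: z_def)
  note zS[measurable] = Sm[OF D_D0, OF zD]
  define d where "d j t = \<bar>S (z j) t - S (z (Suc j)) t\<bar>" for j t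
  have dm[measurable]: "d j \<in> borel_measurable M" for j unfolding d_def[abs_def] by measurable
  have d2: "d j t \<le> 2" for j t
    using S1[OF D_D0, OF zD, of j t] S1[OF D_D0, OF zD, of "Suc j" t] by (simp add: d_def)
  have di: "integrable M (\<lambda>t. (d j t)\<^sup>2)" "integrable M (d j)" for j
  proof -
    have "(d j t)\<^sup>2 \<le> 2\<^sup>2" for t using d2 by (intro power_mono) (auto simp: d_def)
    then show "integrable M (\<lambda>t. (d j t)\<^sup>2)"
      by (intro integrable_const_bound[where B = "2\<^sup>2"]) auto
    show "integrable M (d j)"
      using d2 by (intro integrable_const_bound[where B = 2]) (auto simp: d_def)
  qed
  have d_int: "(LINT t|M. d j t) \<le> (measure M (space M) + 1) * (1/2) ^ j" for j
  proof -
    \<comment> \<open>The weights \<open>2 ^ j\<close> turn the bound \<open>(1/4) ^ j\<close> on the integral of the square into a summable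
      bound on the integral itself.\<close>
    have "(LINT t|M. d j t) \<le> (LINT t|M. (1/2) ^ j + 2 ^ j * (d j t)\<^sup>2)"
    proof (intro integral_mono)
      fix t
      define P where "P = (2::real) ^ j"
      have P: "0 < P" by (simp add: P_def)
      have "0 \<le> (d j t * P - 1)\<^sup>2 + d j t * P" using P by (auto simp: d_def)
      then have "d j t * P \<le> 1 + (d j t * P)\<^sup>2" by (simp add: power2_eq_square algebra_simps)
      then have "d j t \<le> (1 + (d j t * P)\<^sup>2) / P" using P by (simp add: pos_le_divide_eq)
      also have "\<dots> = 1 / P + P * (d j t)\<^sup>2"
        using P by (simp add: add_divide_distrib power2_eq_square)
      finally show "d j t \<le> (1/2) ^ j + 2 ^ j * (d j t)\<^sup>2"
        by (simp add: P_def power_one_over)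
    qed (use di in auto)
    also have "\<dots> = measure M (space M) * (1/2) ^ j + 2 ^ j * (LINT t|M. (d j t)\<^sup>2)"
      using di by simp
    also have "(LINT t|M. (d j t)\<^sup>2) \<le> (1/4) ^ j"
      using gap[of "r j" "r (Suc j)"] r[of j] by (simp add: d_def z_def)
    also have "2 ^ j * (1/4) ^ j = (1/2 :: real) ^ j" by (simp flip: power_mult_distrib)
    finally show ?thesis by (simp add: algebra_simps)
  qed
  have "(\<integral>\<^sup>+ t. (\<Sum>j. ennreal (d j t)) \<partial>M) = (\<Sum>j. \<integral>\<^sup>+ t. ennreal (d j t) \<partial>M)"
    by (intro nn_integral_suminf) measurable
  also have "\<dots> = (\<Sum>j. ennreal (LINT t|M. d j t))"
    by (intro suminf_cong nn_integral_eq_integral di) (auto simp: d_def)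
  also have "\<dots> < top"
  proof -
    have "summable (\<lambda>j. LINT t|M. d j t)"
    proof (rule summable_comparison_test')
      show "summable (\<lambda>j. (measure M (space M) + 1) * (1/2) ^ j)"
        by (intro summable_mult summable_geometric) simp
      show "norm (LINT t|M. d j t) \<le> (measure M (space M) + 1) * (1/2) ^ j" for j
        using d_int[of j] by (simp add: abs_of_nonneg d_def)
    qed
    moreover have "0 \<le> (LINT t|M. d j t)" for j by (simp add: d_def)
    ultimately show ?thesis by (simp add: suminf_ennreal2)
  qed
  finally have "AE t in M. (\<Sum>j. ennreal (d j t)) \<noteq> \<infinity>"
    by (intro nn_integral_PInf_AE) auto
  then have "AE t in M. convergent (\<lambda>j. T (z j) t)"
  proof eventually_elim
    case (elim t)
    then have "summable (\<lambda>j. d j t)" by (intro summable_suminf_not_top) (auto simp: d_def)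
    then have "summable (\<lambda>j. S (z (Suc j)) t - S (z j) t)"
      by - (rule summable_norm_cancel, simp add: d_def abs_minus_commute)
    then have "convergent (\<lambda>n. \<Sum>j<n. S (z (Suc j)) t - S (z j) t)"
      by (simp only: summable_iff_convergent)
    then have "convergent (\<lambda>n. S (z n) t - S (z 0) t)"
      by (simp only: sum_lessThan_telescope[of "\<lambda>j. S (z j) t"])
    then have "convergent (\<lambda>j. S (z j) t)" by (rule convergent_diff_const_right_iff[THEN iffD1])
    then have "convergent (\<lambda>j. S (z j) t * (1 + G t))"
      by (rule convergent_mult[OF _ convergent_const])
    moreover have "S (z j) t * (1 + G t) = T (z j) t" for j
      using G0[of t] by (simp add: S_def)
    ultimately show ?case by (simp only:)
  qed
  with zD show ?thesis unfolding D_def by (rule that)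
qed

text \<open>
  Off the set \<open>E j\<close> where \<open>\<bar>u j - v\<bar>\<close> exceeds \<open>\<epsilon>\<close> the integrand is small; on \<open>E j\<close>, whose measure tends
  to \<open>0\<close> by dominated convergence of its indicator functions, the integrals of \<open>u j\<close> and \<open>v\<close> are
  small separately.
\<close>
lemma Vitali_convergence:
  fixes u :: "nat \<Rightarrow> 'b \<Rightarrow> real"
  assumes fin: "finite_measure M" and u: "\<And>j. integrable M (u j)" and v: "integrable M v"
    and lim: "AE t in M. (\<lambda>j. u j t) \<longlonglongrightarrow> v t"
    and uac: "\<And>e. 0 < e \<Longrightarrow> \<exists>\<delta>>0. \<forall>E\<in>sets M. measure M E < \<delta> \<longrightarrow>
      (\<forall>j. (LINT t:E|M. \<bar>u j t\<bar>) \<le> e) \<and> (LINT t:E|M. \<bar>v t\<bar>) \<le> e"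
  shows "(\<lambda>j. LINT t|M. \<bar>u j t - v t\<bar>) \<longlonglongrightarrow> 0"
proof (rule tendstoI)
  interpret finite_measure M by (fact fin)
  note [measurable] = borel_measurable_integrable[OF u] borel_measurable_integrable[OF v]
  fix e :: real assume e: "0 < e"
  define \<epsilon> where "\<epsilon> = e / (measure M (space M) + 3)"
  have mp: "0 < measure M (space M) + 3" using measure_nonneg[of M "space M"] by linarith
  then have \<epsilon>: "0 < \<epsilon>" using e by (simp add: \<epsilon>_def)
  obtain \<delta> where \<delta>: "0 < \<delta>" "\<And>E j. E \<in> sets M \<Longrightarrow> measure M E < \<delta> \<Longrightarrow> (LINT t:E|M. \<bar>u j t\<bar>) \<le> \<epsilon>"
    "\<And>E. E \<in> sets M \<Longrightarrow> measure M E < \<delta> \<Longrightarrow> (LINT t:E|M. \<bar>v t\<bar>) \<le> \<epsilon>"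
    using uac[OF \<epsilon>] by blast
  define E where "E j = {t\<in>space M. \<epsilon> < \<bar>u j t - v t\<bar>}" for j
  have Em[measurable]: "E j \<in> sets M" for j unfolding E_def by measurable
  have "(\<lambda>j. LINT t|M. indicator (E j) t :: real) \<longlonglongrightarrow> (LINT t|M. 0)"
  proof (rule integral_dominated_convergence[where w = "\<lambda>_. 1"])
    show "AE t in M. (\<lambda>j. indicator (E j) t :: real) \<longlonglongrightarrow> 0"
      using lim
    proof eventually_elim
      case (elim t)
      then have "\<forall>\<^sub>F j in sequentially. \<bar>u j t - v t\<bar> < \<epsilon>" using \<epsilon> by (auto dest: tendstoD simp: dist_real_def)
      then have "\<forall>\<^sub>F j in sequentially. indicator (E j) t = (0::real)"
        by eventually_elim (simp add: E_def)
      then show ?case by (rule tendsto_eventually)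
    qed
  qed (auto simp: indicator_def)
  then have "(\<lambda>j. measure M (E j)) \<longlonglongrightarrow> 0" by simp
  then have "\<forall>\<^sub>F j in sequentially. measure M (E j) < \<delta>" using \<delta>(1) by (rule order_tendstoD)
  then show "\<forall>\<^sub>F j in sequentially. dist (LINT t|M. \<bar>u j t - v t\<bar>) 0 < e"
  proof eventually_elim
    case (elim j)
    have int: "integrable M (\<lambda>t. indicator (E j) t * \<bar>u j t\<bar>)" "integrable M (\<lambda>t. indicator (E j) t * \<bar>v t\<bar>)"
      using integrable_mult_indicator[OF Em[of j] integrable_abs[OF u[of j]]]
        integrable_mult_indicator[OF Em[of j] integrable_abs[OF v]] by simp_all
    have "(LINT t|M. \<bar>u j t - v t\<bar>) \<le>
        (LINT t|M. \<epsilon> + indicator (E j) t * \<bar>u j t\<bar> + indicator (E j) t * \<bar>v t\<bar>)"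
    proof (rule integral_mono)
      fix t assume "t \<in> space M"
      then show "\<bar>u j t - v t\<bar> \<le> \<epsilon> + indicator (E j) t * \<bar>u j t\<bar> + indicator (E j) t * \<bar>v t\<bar>"
        using \<epsilon> by (auto simp: E_def indicator_def)
    qed (use int u v in auto)
    also have "\<dots> = \<epsilon> * measure M (space M) + (LINT t:E j|M. \<bar>u j t\<bar>) + (LINT t:E j|M. \<bar>v t\<bar>)"
      using int by (simp add: set_lebesgue_integral_def)
    also have "\<dots> \<le> \<epsilon> * measure M (space M) + \<epsilon> + \<epsilon>"
      using \<delta>(2,3)[OF Em elim] by (intro add_mono) auto
    also have "\<dots> = \<epsilon> * (measure M (space M) + 2)" by (simp add: algebra_simps)
    also have "\<dots> < \<epsilon> * (measure M (space M) + 3)" using \<epsilon> by simp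
    also have "\<dots> = e" using mp by (simp add: \<epsilon>_def)
    finally show ?case by (simp add: abs_of_nonneg)
  qed
qed

section \<open>The limit theorem\<close>

text \<open>
  A bound on \<open>\<bar>\<integral>\<^bsub>B\<^esub> f g\<^sub>n dm\<^sub>n\<bar>\<close> that holds for all measurable \<open>B \<subseteq> A\<close> passes to the limit, and
  the integral of \<open>\<bar>f g\<bar>\<close> over \<open>A\<close> is recovered from the two sets \<open>B\<close> on which \<open>f g\<close> has constant
  sign.
\<close>
lemma uac_scalar_integrals_of_limit:
  fixes g :: "'b \<Rightarrow> 'a::real_normed_vector"
  assumes fin: "finite_measure m" and sets: "\<And>n. sets (mn n) = sets m"
    and uac: "scalarly_uac_integrals mn gn" and g: "scalarly_integrable m g"
    and mn: "uniformly_absolutely_continuous m mn"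
    and lim: "\<And>A (f :: 'a \<Rightarrow>\<^sub>L real). A \<in> sets m \<Longrightarrow>
      (\<lambda>n. LINT t:A|mn n. blinfun_apply f (gn n t)) \<longlonglongrightarrow> (LINT t:A|m. blinfun_apply f (g t))"
    and e: "0 < e"
  shows "\<exists>\<delta>>0. \<forall>A\<in>sets m. measure m A < \<delta> \<longrightarrow>
    (\<forall>f :: 'a \<Rightarrow>\<^sub>L real. norm f \<le> 1 \<longrightarrow> (LINT t:A|m. \<bar>blinfun_apply f (g t)\<bar>) \<le> e)"
proof -
  interpret finite_measure m by (fact fin)
  have "0 < e / 2" using e by simp
  from conjunct2[OF uac[unfolded scalarly_uac_integrals_def sets], THEN spec, THEN mp, OF this]
  obtain \<delta>' where \<delta>': "0 < \<delta>'" and fam: "\<And>n A. A \<in> sets m \<Longrightarrow> emeasure (mn n) A < ennreal \<delta>' \<Longrightarrow>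
      (SUP f\<in>{f :: 'a \<Rightarrow>\<^sub>L real. norm f \<le> 1}.
         ennreal (LINT t:A|mn n. \<bar>blinfun_apply f (gn n t)\<bar>)) < ennreal (e / 2)"
    by blast
  from mn[unfolded uniformly_absolutely_continuous_def, THEN spec, THEN mp, OF \<delta>']
  obtain \<delta> where \<delta>: "0 < \<delta>" and meas: "\<And>E. E \<in> sets m \<Longrightarrow> emeasure m E < ennreal \<delta> \<Longrightarrow> (SUP n. emeasure (mn n) E) < ennreal \<delta>'"
    by blast
  have gi: "integrable m (\<lambda>t. blinfun_apply f (g t))" for f :: "'a \<Rightarrow>\<^sub>L real"
    using g by (simp add: scalarly_integrable_def)
  have "(LINT t:A|m. \<bar>blinfun_apply f (g t)\<bar>) \<le> e"
    if A: "A \<in> sets m" and small: "measure m A < \<delta>" and f: "norm f \<le> 1" for A and f :: "'a \<Rightarrow>\<^sub>L real"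
  proof -
    have "emeasure m A < ennreal \<delta>"
      using small by (simp add: emeasure_eq_measure ennreal_less_iff)
    then have mnA: "emeasure (mn n) A < ennreal \<delta>'" for n
      by (intro SUP_lessD[OF meas[OF A]]) simp_all
    have half: "\<bar>LINT t:B|m. blinfun_apply f (g t)\<bar> \<le> e / 2" if B: "B \<in> sets m" "B \<subseteq> A" for B
    proof -
      have "\<bar>LINT t:B|mn n. blinfun_apply f (gn n t)\<bar> \<le> e / 2" for n
      proof -
        have "emeasure (mn n) B < ennreal \<delta>'"
          using emeasure_mono[of B A "mn n"] B A sets mnA[of n] by (auto intro: le_less_trans)
        then have "ennreal (LINT t:B|mn n. \<bar>blinfun_apply f (gn n t)\<bar>) < ennreal (e / 2)"
          using SUP_lessD[OF fam[OF B(1)], of n f] f by simp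
        then have "(LINT t:B|mn n. \<bar>blinfun_apply f (gn n t)\<bar>) < e / 2"
          using e by (simp add: ennreal_less_iff set_lebesgue_integral_def)
        moreover have "\<bar>LINT t:B|mn n. blinfun_apply f (gn n t)\<bar> \<le> (LINT t:B|mn n. \<bar>blinfun_apply f (gn n t)\<bar>)"
          using integral_abs_bound[of "mn n" "\<lambda>t. indicator B t * blinfun_apply f (gn n t)"]
          by (simp add: set_lebesgue_integral_def abs_mult)
        ultimately show ?thesis by simp
      qed
      then show ?thesis
        by (intro LIMSEQ_le_const2[OF tendsto_rabs[OF lim[OF B(1), of f]]]) auto
    qed
    define P where "P = {t\<in>space m. 0 \<le> blinfun_apply f (g t)} \<inter> A"
    have [measurable]: "(\<lambda>t. blinfun_apply f (g t)) \<in> borel_measurable m"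
      using gi by (rule borel_measurable_integrable)
    have P: "P \<in> sets m" "P \<subseteq> A" using A unfolding P_def by auto
    have split: "indicator A t * \<bar>blinfun_apply f (g t)\<bar> =
        indicator P t * blinfun_apply f (g t) - indicator (A - P) t * blinfun_apply f (g t)" if "t \<in> space m" for t
      using that by (auto simp: P_def indicator_def)
    have ind: "integrable m (\<lambda>t. indicator B t * blinfun_apply f (g t))" if "B \<in> sets m" for B
      using integrable_mult_indicator[OF that gi[of f]] by simp
    have "(LINT t:A|m. \<bar>blinfun_apply f (g t)\<bar>) =
        (LINT t:P|m. blinfun_apply f (g t)) - (LINT t:A - P|m. blinfun_apply f (g t))"
      using P A ind by (simp add: set_lebesgue_integral_def split cong: Bochner_Integration.integral_cong)
    also have "\<dots> \<le> e / 2 + e / 2" using half[OF P] half[of "A - P"] P A by auto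
    finally show ?thesis by simp
  qed
  with \<delta> show ?thesis by blast
qed

text \<open>
  Membership of a weak-star limit of the points \<open>y n\<close> in the space itself rests on \<open>g\<close> being a
  function with values in the space: generalized limits of functionals act pointwise on \<open>g\<close>, and
  therefore are compatible with almost everywhere convergence.
\<close>
lemma Pettis_integral_of_limit:
  fixes g :: "'b \<Rightarrow> 'a::banach"
  assumes fin: "finite_measure m" and g: "scalarly_integrable m g" and A: "A \<in> sets m"
    and uac: "\<And>e. 0 < e \<Longrightarrow> \<exists>\<delta>>0. \<forall>E\<in>sets m. measure m E < \<delta> \<longrightarrow>
      (\<forall>f :: 'a \<Rightarrow>\<^sub>L real. norm f \<le> 1 \<longrightarrow> (LINT t:E|m. \<bar>blinfun_apply f (g t)\<bar>) \<le> e)"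
    and y: "\<And>f :: 'a \<Rightarrow>\<^sub>L real. (\<lambda>n. blinfun_apply f (y n)) \<longlonglongrightarrow> (LINT t:A|m. blinfun_apply f (g t))"
  shows "\<exists>\<nu>. \<forall>f :: 'a \<Rightarrow>\<^sub>L real. blinfun_apply f \<nu> = (LINT t:A|m. blinfun_apply f (g t))"
proof -
  define \<phi> where "\<phi> f = (LINT t:A|m. blinfun_apply f (g t))" for f :: "'a \<Rightarrow>\<^sub>L real"
  have gi: "integrable m (\<lambda>t. blinfun_apply f (g t))" for f :: "'a \<Rightarrow>\<^sub>L real"
    using g by (simp add: scalarly_integrable_def)
  have giA: "integrable m (\<lambda>t. indicator A t * blinfun_apply f (g t))" for f :: "'a \<Rightarrow>\<^sub>L real"
    using integrable_mult_indicator[OF A gi[of f]] by simp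
  have \<phi>: "linear \<phi>"
    by (intro linearI) (simp_all add: \<phi>_def set_lebesgue_integral_def blinfun.add_left
        blinfun.scaleR_left distrib_left giA mult.left_commute)
  have "\<exists>u. \<forall>f :: 'a \<Rightarrow>\<^sub>L real. \<phi> f = blinfun_apply f u"
  proof (rule represented_by_point_if_small_on_annihilators[OF \<phi>, of y], rule ccontr)
    fix c :: real assume c: "0 < c"
    define C where "C k = {h :: 'a \<Rightarrow>\<^sub>L real. norm h \<le> 1 \<and> (\<forall>i<k. blinfun_apply h (y i) = 0) \<and> c \<le> \<phi> h}" for k
    assume no: "\<nexists>k. \<forall>f :: 'a \<Rightarrow>\<^sub>L real. (\<forall>i<k. blinfun_apply f (y i) = 0) \<longrightarrow> \<bar>\<phi> f\<bar> \<le> c * norm f"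
    \<comment> \<open>The factor \<open>sgn (\<phi> f)\<close> turns the bound on \<open>\<bar>\<phi> f\<bar>\<close> into the one-sided bound
      \<open>c \<le> \<phi> h\<close>, which convex combinations keep.\<close>
    have "\<exists>h. h \<in> C k" for k
    proof -
      from no obtain f :: "'a \<Rightarrow>\<^sub>L real" where f: "\<forall>i<k. blinfun_apply f (y i) = 0" "c * norm f < \<bar>\<phi> f\<bar>"
        by (meson not_le)
      then have "f \<noteq> 0" using linear_0[OF \<phi>] by auto
      then have "norm ((sgn (\<phi> f) / norm f) *\<^sub>R f) \<le> 1" by (simp add: abs_sgn_eq)
      moreover have "\<phi> ((sgn (\<phi> f) / norm f) *\<^sub>R f) = \<bar>\<phi> f\<bar> / norm f"
        by (simp add: linear_scale[OF \<phi>] abs_sgn mult.commute)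
      moreover have "c \<le> \<bar>\<phi> f\<bar> / norm f" using f(2) \<open>f \<noteq> 0\<close> by (simp add: field_simps)
      ultimately have "(sgn (\<phi> f) / norm f) *\<^sub>R f \<in> C k"
        using f(1) by (simp add: C_def blinfun.scaleR_left)
      then show ?thesis ..
    qed
    then obtain x where x: "\<And>k. x k \<in> C k" by metis
    have C_anti: "C k \<subseteq> C j" if "j \<le> k" for j k using that by (auto simp: C_def)
    have C_convex: "convex (C k)" for k
    proof -
      have "C k = cball 0 1 \<inter> {h. \<forall>i<k. blinfun_apply h (y i) = 0} \<inter> \<phi> -` {c..}"
        by (auto simp: C_def)
      moreover have "convex {h :: 'a \<Rightarrow>\<^sub>L real. \<forall>i<k. blinfun_apply h (y i) = 0}"
        by (auto simp: convex_def blinfun.add_left blinfun.scaleR_left)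
      ultimately show ?thesis
        by (auto intro!: convex_Int convex_linear_vimage \<phi>)
    qed
    have bound: "\<bar>blinfun_apply h t\<bar> \<le> norm t" if "norm h \<le> 1" for h :: "'a \<Rightarrow>\<^sub>L real" and t
      using norm_blinfun[of h t] mult_right_mono[OF that, of "norm t"] by simp
    obtain z where z: "\<And>j. z j \<in> convex hull (x ` {j..})"
      and conv: "AE t in m. convergent (\<lambda>j. blinfun_apply (z j) (g t))"
    proof (rule forward_convex_combinations_AE_convergent[OF fin,
          of "\<lambda>h t. blinfun_apply h (g t)" x "\<lambda>t. norm (g t)"])
      show "linear (\<lambda>h. blinfun_apply h (g t))" for t
        by (intro linearI) (simp_all add: blinfun.add_left blinfun.scaleR_left)
      show "\<bar>blinfun_apply (x n) (g t)\<bar> \<le> norm (g t)" for n t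
        using x[of n] by (intro bound) (simp add: C_def)
    qed (use gi in auto)
    have zC: "z j \<in> C j" for j
    proof -
      have "convex hull (x ` {j..}) \<subseteq> C j"
        using x C_anti by (intro hull_minimal C_convex) auto
      with z show ?thesis by blast
    qed
    then have z1: "norm (z j) \<le> 1" for j by (simp add: C_def)
    then obtain G :: "'a \<Rightarrow>\<^sub>L real" where G: "norm G \<le> 1"
      and G_lim: "\<And>x l. (\<lambda>j. blinfun_apply (z j) x) \<longlonglongrightarrow> l \<Longrightarrow> blinfun_apply G x = l"
      using bounded_functionals_generalized_limit[of z] by blast
    have "(\<lambda>j. LINT t|m. \<bar>blinfun_apply (z j) (g t) - blinfun_apply G (g t)\<bar>) \<longlonglongrightarrow> 0"
    proof (rule Vitali_convergence[OF fin gi gi])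
      show "AE t in m. (\<lambda>j. blinfun_apply (z j) (g t)) \<longlonglongrightarrow> blinfun_apply G (g t)"
        using conv by eventually_elim (metis G_lim convergent_def)
      show "\<exists>\<delta>>0. \<forall>E\<in>sets m. measure m E < \<delta> \<longrightarrow> (\<forall>j. (LINT t:E|m. \<bar>blinfun_apply (z j) (g t)\<bar>) \<le> e) \<and>
          (LINT t:E|m. \<bar>blinfun_apply G (g t)\<bar>) \<le> e" if "0 < e" for e
        using uac[OF that] z1 G by meson
    qed
    moreover have "c - \<phi> G \<le> (LINT t|m. \<bar>blinfun_apply (z j) (g t) - blinfun_apply G (g t)\<bar>)" for j
    proof -
      have "c - \<phi> G \<le> \<phi> (z j) - \<phi> G" using zC[of j] by (simp add: C_def)
      also have "\<dots> = (LINT t|m. indicator A t * blinfun_apply (z j) (g t) - indicator A t * blinfun_apply G (g t))"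
        using giA by (simp add: \<phi>_def set_lebesgue_integral_def)
      also have "\<dots> \<le> (LINT t|m. \<bar>blinfun_apply (z j) (g t) - blinfun_apply G (g t)\<bar>)"
        by (intro integral_mono integrable_abs Bochner_Integration.integrable_diff giA gi)
          (auto simp: indicator_def)
      finally show ?thesis .
    qed
    ultimately have "c - \<phi> G \<le> 0" by (intro LIMSEQ_le_const) auto
    moreover have "\<phi> G = 0"
    proof -
      have "blinfun_apply G (y i) = 0" for i
      proof (rule G_lim, rule tendsto_eventually)
        show "\<forall>\<^sub>F j in sequentially. blinfun_apply (z j) (y i) = 0"
          using eventually_gt_at_top[of i] by eventually_elim (use zC in \<open>simp add: C_def\<close>)
      qed
      with y[of G] show ?thesis by (simp add: \<phi>_def LIMSEQ_const_iff)
    qed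
    ultimately show False using c by simp
  qed
  then show ?thesis unfolding \<phi>_def by metis
qed

theorem corollary4p5:
  fixes \<Omega> :: "'b set" and \<A> :: "'b set set"
    and m :: "'b measure" and mn :: "nat \<Rightarrow> 'b measure"
    and g :: "'b \<Rightarrow> 'a::banach" and gn :: "nat \<Rightarrow> 'b \<Rightarrow> 'a"
  assumes "space m = \<Omega>" and "sets m = \<A>"
    and "\<And>n. space (mn n) = \<Omega>" and "\<And>n. sets (mn n) = \<A>"
    and "finite_measure m" and "\<And>n. finite_measure (mn n)"
    and "scalarly_measurable m g" and "\<And>n. scalarly_measurable m (gn n)"
    and j: "scalarly_uac_integrals mn gn"
    and jj: "scalarly_integrable m g"
    and jjj: "uniformly_absolutely_continuous m mn"
    and jv: "\<And>n. Pettis_integrable (mn n) (gn n)"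
    and v: "\<And>A (f :: 'a \<Rightarrow>\<^sub>L real). A \<in> \<A> \<Longrightarrow>
      (\<lambda>n. LINT t:A|mn n. blinfun_apply f (gn n t))
        \<longlonglongrightarrow> (LINT t:A|m. blinfun_apply f (g t))"
  shows "Pettis_integrable m g"
  unfolding Pettis_integrable_def
proof (intro conjI jj ballI)
  fix A assume A: "A \<in> sets m"
  have sets: "sets (mn n) = sets m" for n using assms(2,4) by simp
  have lim: "(\<lambda>n. LINT t:B|mn n. blinfun_apply f (gn n t)) \<longlonglongrightarrow> (LINT t:B|m. blinfun_apply f (g t))"
    if "B \<in> sets m" for B and f :: "'a \<Rightarrow>\<^sub>L real"
    using v that assms(2) by simp
  have "\<exists>u. \<forall>f :: 'a \<Rightarrow>\<^sub>L real. blinfun_apply f u = (LINT t:A|mn n. blinfun_apply f (gn n t))" for n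
    using jv[of n] A sets unfolding Pettis_integrable_def by blast
  then obtain y where "\<And>n (f :: 'a \<Rightarrow>\<^sub>L real).
      blinfun_apply f (y n) = (LINT t:A|mn n. blinfun_apply f (gn n t))" by metis
  with lim[OF A] have "(\<lambda>n. blinfun_apply f (y n)) \<longlonglongrightarrow> (LINT t:A|m. blinfun_apply f (g t))"
    for f :: "'a \<Rightarrow>\<^sub>L real" by simp
  with uac_scalar_integrals_of_limit[OF \<open>finite_measure m\<close> sets j jj jjj lim]
  show "\<exists>\<nu>. \<forall>f :: 'a \<Rightarrow>\<^sub>L real. blinfun_apply f \<nu> = (LINT t:A|m. blinfun_apply f (g t))"
    by (rule Pettis_integral_of_limit[OF \<open>finite_measure m\<close> jj A])
qed

end
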